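(* Let $E \subseteq \mathbb{R}^2$ be a $1$-separated set (any two distinct points of $E$ are at distance at least $1$). For $u > 0$ and $v \in \mathbb{R}$ let \[t_{u,v} = \left\{(x,y) \in \mathbb{R}^2 \;:\; -\tfrac{1}{u}x + v\sqrt{1+\tfrac{1}{u^2}} < y \leq -\tfrac{1}{u}x + (v+1)\sqrt{1+\tfrac{1}{u^2}}\right\}.\] Then for every $v \in \mathbb{R}$ and Lebesgue-almost every $u \in (0,\infty)$, \[\overline{D}(E \cap t_{u,v}) \leq \max\big(0, \overline{D}(E) - 1\big).\]
   Context: For a $1$-separated set $F \subseteq \mathbb{R}^2$, the mass dimension is $\overline{D}(F) = \limsup_{l\to\infty} \frac{\log |F \cap [-l,l]^2|}{\log (2l)}$, where $|\cdot|$ denotes cardinality and $\log 0 = -\infty$. *)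

theory Defs
  imports "HOL-Analysis.Analysis"
begin

definition one_separated :: "(real \<times> real) set \<Rightarrow> bool" where
  "one_separated E \<longleftrightarrow> (\<forall>p\<in>E. \<forall>q\<in>E. p \<noteq> q \<longrightarrow> dist p q \<ge> 1)"

text \<open>The logarithm of a cardinality, with the convention \<open>log 0 = - \<infinity>\<close>
  (HOL itself has \<open>ln 0 = 0\<close>).  Only meant for finite sets: a one-separated subset
  of a square is finite.\<close>

definition log_card :: "'a set \<Rightarrow> ereal" where
  "log_card A = (if A = {} then - \<infinity> else ereal (ln (real (card A))))"

text \<open>The upper limit is over real \<open>l\<close>, with extended real values; the denominator is
  positive once \<open>l > 1/2\<close>.  The empty set has dimension \<open>- \<infinity>\<close>.\<close>

definition mass_dimension :: "(real \<times> real) set \<Rightarrow> ereal" where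
  "mass_dimension F =
     Limsup at_top (\<lambda>l::real. log_card (F \<inter> ({-l..l} \<times> {-l..l})) / ereal (ln (2 * l)))"

definition tube :: "real \<Rightarrow> real \<Rightarrow> (real \<times> real) set" where
  "tube u v = {(x, y).
     - (1 / u) * x + v * sqrt (1 + 1 / u\<^sup>2) < y \<and>
     y \<le> - (1 / u) * x + (v + 1) * sqrt (1 + 1 / u\<^sup>2)}"

end

theory Submission
  imports Defs
begin

text \<open>Fix \<open>M\<close>. For a point \<open>p\<close> at distance about \<open>r\<close> from the origin, the parameters
  \<open>u \<le> M\<close> with \<open>p \<in> tube u v\<close> lie in an interval of length \<open>O(1/r)\<close>. Hence the number
  \<open>N\<^sub>k(u)\<close> of points of \<open>E \<inter> tube u v\<close> in the \<open>k\<close>-th dyadic square annulus has integral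
  \<open>O(2\<^bsup>k(d' - 1)\<^esup>)\<close> over \<open>u \<le> M\<close>, for every \<open>d'\<close> above the dimension of \<open>E\<close>. If \<open>d > d'\<close> and \<open>d > 1\<close>,
  the series \<open>\<Sum>\<^sub>k 2\<^bsup>-k(d - 1)\<^esup> N\<^sub>k(u)\<close> has a finite integral, so it converges for almost every
  \<open>u\<close>, which bounds the growth of \<open>E \<inter> tube u v\<close> by the exponent \<open>d - 1\<close>.\<close>

section \<open>Counting in squares versus mass dimension\<close>

abbreviation square :: "real \<Rightarrow> (real \<times> real) set" where
  "square l \<equiv> {-l..l} \<times> {-l..l}"

lemma one_separated_imp_finite_square:
  assumes "one_separated E"
  shows "finite (E \<inter> square l)"
proof -
  have "uniform_discrete (E \<inter> square l)"
    using assms unfolding uniform_discrete_def one_separated_def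
    by (intro exI[of _ 1]) force
  moreover have "bounded (square l)"
    by (intro bounded_Times) auto
  then have "bounded (E \<inter> square l)"
    by (rule bounded_subset) auto
  ultimately show ?thesis
    using uniform_discrete_finite_iff by blast
qed

text \<open>The upper limit controls the count only for large \<open>l\<close>. Smaller
  \<open>l\<close> are absorbed into \<open>K\<close>: the count is monotone in \<open>l\<close>,
  and \<open>(2 * l) powr d\<close> is at least 1 because \<open>0 \<le> d\<close>. A bound valid
  from \<open>l = 1\<close> on can then be applied at every dyadic scale.\<close>

lemma card_le_powr_of_mass_dimension_less:
  assumes fin: "\<And>l. finite (E \<inter> square l)" and dim: "mass_dimension E < ereal d" and "0 \<le> d"
  obtains K where "0 \<le> K" "\<And>l. 1 \<le> l \<Longrightarrow> real (card (E \<inter> square l)) \<le> K * (2 * l) powr d"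
proof -
  obtain L0 where L0: "\<And>l. L0 \<le> l \<Longrightarrow> log_card (E \<inter> square l) / ereal (ln (2 * l)) < ereal d"
    using Limsup_lessD[OF dim[unfolded mass_dimension_def]] unfolding eventually_at_top_linorder by blast
  define L where "L = max L0 1"
  have large: "real (card (E \<inter> square l)) \<le> (2 * l) powr d" if "L \<le> l" for l
  proof (cases "E \<inter> square l = {}")
    case False
    have l: "1 \<le> l" "L0 \<le> l" using that by (auto simp: L_def)
    have pos: "0 < ln (2 * l)" using l by simp
    have c: "0 < card (E \<inter> square l)" using False fin by (simp add: card_gt_0_iff)
    have "ln (real (card (E \<inter> square l))) / ln (2 * l) < d"
      using L0[OF l(2)] False pos by (simp add: log_card_def)
    then have "ln (real (card (E \<inter> square l))) \<le> ln ((2 * l) powr d)"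
      using pos l by (simp add: field_simps)
    then show ?thesis using c l by (subst (asm) ln_le_cancel_iff) auto
  qed simp
  define K where "K = max 1 (real (card (E \<inter> square L)))"
  have "real (card (E \<inter> square l)) \<le> K * (2 * l) powr d" if "1 \<le> l" for l
  proof (cases "L \<le> l")
    case True
    then have "real (card (E \<inter> square l)) \<le> 1 * (2 * l) powr d" using large by simp
    also have "\<dots> \<le> K * (2 * l) powr d" by (intro mult_right_mono) (auto simp: K_def)
    finally show ?thesis .
  next
    case False
    then have "card (E \<inter> square l) \<le> card (E \<inter> square L)"
      by (intro card_mono fin) auto
    then have "real (card (E \<inter> square l)) \<le> K * 1" by (auto simp: K_def)
    also have "\<dots> \<le> K * (2 * l) powr d"
      using that \<open>0 \<le> d\<close> by (intro mult_left_mono ge_one_powr_ge_zero) (auto simp: K_def)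
    finally show ?thesis .
  qed
  then show thesis using that[of K] by (auto simp: K_def)
qed

text \<open>After taking logarithms and dividing by \<open>ln (2 * l)\<close>, the constant
  contributes only \<open>ln K' / ln (2 * l)\<close>, which tends to 0.\<close>

lemma mass_dimension_le_of_card_le_powr:
  assumes bound: "\<And>l. 1 \<le> l \<Longrightarrow> real (card (F \<inter> square l)) \<le> K * (2 * l) powr d"
    and fin: "\<And>l. finite (F \<inter> square l)"
  shows "mass_dimension F \<le> ereal d"
proof -
  \<comment> \<open>Raising the constant to at least 1 makes it positive, so that the logarithm of
    the product splits.\<close>
  define K' where "K' = max 1 K"
  have "log_card (F \<inter> square l) / ereal (ln (2 * l)) \<le> ereal (ln K' / ln (2 * l) + d)"
    if "1 \<le> l" for l
  proof (cases "F \<inter> square l = {}")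
    \<comment> \<open>Here the numerator is minus infinity and the denominator is positive, so the
      quotient is minus infinity.\<close>
    case True
    then show ?thesis using that by (simp add: log_card_def)
  next
    case False
    have c: "0 < card (F \<inter> square l)" using False fin by (simp add: card_gt_0_iff)
    have "real (card (F \<inter> square l)) \<le> K' * (2 * l) powr d"
      by (rule order_trans[OF bound[OF that]]) (auto simp: K'_def intro: mult_right_mono)
    then have "ln (real (card (F \<inter> square l))) \<le> ln (K' * (2 * l) powr d)"
      using c that by (subst ln_le_cancel_iff) (auto simp: K'_def)
    also have "\<dots> = ln K' + d * ln (2 * l)"
      using that by (subst ln_mult) (auto simp: K'_def)
    finally have "ln (real (card (F \<inter> square l))) / ln (2 * l) \<le> ln K' / ln (2 * l) + d"
      using that by (simp add: field_simps)
    then show ?thesis using False that by (simp add: log_card_def)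
  qed
  then have "mass_dimension F \<le> Limsup at_top (\<lambda>l::real. ereal (ln K' / ln (2 * l) + d))"
    unfolding mass_dimension_def
    by (intro Limsup_mono) (auto simp: eventually_at_top_linorder)
  also have "\<dots> = ereal d"
  proof (rule lim_imp_Limsup)
    have "filterlim (\<lambda>l::real. ln (2 * l)) at_top at_top"
      by (intro filterlim_compose[OF ln_at_top] filterlim_tendsto_pos_mult_at_top[of _ 2] filterlim_ident) auto
    then have "((\<lambda>l::real. ln K' / ln (2 * l) + d) \<longlongrightarrow> 0 + d) at_top"
      by (intro tendsto_add tendsto_divide_0[OF tendsto_const] tendsto_const filterlim_at_top_imp_at_infinity)
    then show "((\<lambda>l::real. ereal (ln K' / ln (2 * l) + d)) \<longlongrightarrow> ereal d) at_top"
      by (intro tendsto_ereal) simp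
  qed simp
  finally show ?thesis .
qed

section \<open>The parameters whose tube contains a given point\<close>

lemma tube_iff:
  assumes "0 < u"
  shows "(x, y) \<in> tube u v \<longleftrightarrow>
    v * sqrt (1 + u\<^sup>2) < x + u * y \<and> x + u * y \<le> (v + 1) * sqrt (1 + u\<^sup>2)"
proof -
  \<comment> \<open>Clearing the denominator \<open>u\<close> gives conditions that stay bounded as
    \<open>u\<close> tends to 0, so later constants depend on \<open>M\<close> and \<open>v\<close>
    only.\<close>
  have "sqrt (1 + 1 / u\<^sup>2) = sqrt ((1 + u\<^sup>2) / u\<^sup>2)"
    using assms by (intro arg_cong[of _ _ sqrt]) (auto simp: field_simps)
  also have "\<dots> = sqrt (1 + u\<^sup>2) / u"
    using assms by (simp add: real_sqrt_divide)
  finally have *: "sqrt (1 + 1 / u\<^sup>2) = sqrt (1 + u\<^sup>2) / u" .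
  have "- (1 / u) * x + w * sqrt (1 + 1 / u\<^sup>2) = (w * sqrt (1 + u\<^sup>2) - x) / u" for w
    unfolding * by (simp add: diff_divide_distrib)
  then have "(x, y) \<in> tube u v \<longleftrightarrow>
      (v * sqrt (1 + u\<^sup>2) - x) / u < y \<and> y \<le> ((v + 1) * sqrt (1 + u\<^sup>2) - x) / u"
    by (simp only: tube_def mem_Collect_eq prod.case)
  also have "\<dots> \<longleftrightarrow> v * sqrt (1 + u\<^sup>2) < x + u * y \<and> x + u * y \<le> (v + 1) * sqrt (1 + u\<^sup>2)"
    unfolding pos_divide_less_eq[OF assms] pos_le_divide_eq[OF assms]
    by (auto simp: mult.commute[of y u])
  finally show ?thesis .
qed

text \<open>Both parameters \<open>w\<close> satisfy |x + w y| \<le> \<open>B\<close>. Subtracting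
  eliminates \<open>x\<close> and gives |y| |u - u'| \<le> 2 B. Since |x| \<le> B + u |y|, the bound
  for \<open>y\<close> carries over to \<open>x\<close>, with 3 M B in place of 2 B. The sum of the
  two constants serves for the maximum.\<close>

lemma tube_parameters_close:
  assumes u: "0 < u" "u \<le> M" and u': "0 < u'" "u' \<le> M"
    and mem: "(x, y) \<in> tube u v" "(x, y) \<in> tube u' v"
  shows "max \<bar>x\<bar> \<bar>y\<bar> * \<bar>u - u'\<bar> \<le> (2 + 3 * M) * ((\<bar>v\<bar> + 1) * sqrt (1 + M\<^sup>2))"
proof -
  define B where "B = (\<bar>v\<bar> + 1) * sqrt (1 + M\<^sup>2)"
  have *: "\<bar>x + w * y\<bar> \<le> B" if w: "0 < w" "w \<le> M" "(x, y) \<in> tube w v" for w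
  proof -
    have "\<bar>x + w * y\<bar> \<le> (\<bar>v\<bar> + 1) * sqrt (1 + w\<^sup>2)"
    proof -
      have s: "0 \<le> sqrt (1 + w\<^sup>2)" by simp
      have "- (\<bar>v\<bar> + 1) * sqrt (1 + w\<^sup>2) \<le> v * sqrt (1 + w\<^sup>2)"
        "(v + 1) * sqrt (1 + w\<^sup>2) \<le> (\<bar>v\<bar> + 1) * sqrt (1 + w\<^sup>2)"
        by (intro mult_right_mono s; linarith)+
      then show ?thesis using w(3) unfolding tube_iff[OF w(1)] by linarith
    qed
    also have "\<dots> \<le> B"
      unfolding B_def using w by (intro mult_left_mono) (auto intro: power_mono)
    finally show ?thesis .
  qed
  have a: "\<bar>x + u * y\<bar> \<le> B" and b: "\<bar>x + u' * y\<bar> \<le> B" using * assms by auto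
  have B: "0 \<le> B" unfolding B_def by simp
  have "\<bar>y\<bar> * \<bar>u - u'\<bar> = \<bar>(x + u * y) - (x + u' * y)\<bar>"
    by (simp add: abs_mult[symmetric] algebra_simps)
  also have "\<dots> \<le> 2 * B" using a b by linarith
  finally have y: "\<bar>y\<bar> * \<bar>u - u'\<bar> \<le> 2 * B" .
  have "\<bar>x\<bar> \<le> B + u * \<bar>y\<bar>"
    using a u abs_mult[of u y] by (simp add: abs_if split: if_splits)
  then have "\<bar>x\<bar> * \<bar>u - u'\<bar> \<le> (B + u * \<bar>y\<bar>) * \<bar>u - u'\<bar>"
    by (intro mult_right_mono) auto
  also have "\<dots> = B * \<bar>u - u'\<bar> + u * (\<bar>y\<bar> * \<bar>u - u'\<bar>)" by (simp add: algebra_simps)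
  also have "\<dots> \<le> B * M + M * (2 * B)"
  proof (intro add_mono)
    \<comment> \<open>Both parameters lie in (0, M], so they differ by at most
      \<open>M\<close>.\<close>
    show "B * \<bar>u - u'\<bar> \<le> B * M" using u u' B by (intro mult_left_mono) auto
    show "u * (\<bar>y\<bar> * \<bar>u - u'\<bar>) \<le> M * (2 * B)" using u y by (intro mult_mono[OF u(2) y]) auto
  qed
  finally have "\<bar>x\<bar> * \<bar>u - u'\<bar> \<le> 3 * M * B" by (simp add: algebra_simps)
  moreover have "0 \<le> M * B" using u B by simp
  ultimately have "\<bar>x\<bar> * \<bar>u - u'\<bar> \<le> 2 * B + 3 * (M * B)" "\<bar>y\<bar> * \<bar>u - u'\<bar> \<le> 2 * B + 3 * (M * B)"
    using y B by linarith+
  then have "max \<bar>x\<bar> \<bar>y\<bar> * \<bar>u - u'\<bar> \<le> 2 * B + 3 * (M * B)"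
    by (cases "\<bar>x\<bar> \<le> \<bar>y\<bar>") (simp_all only: max_absorb1 max_absorb2 not_le less_imp_le)
  then show ?thesis unfolding B_def[symmetric] by (simp add: algebra_simps)
qed

lemma sets_tube_parameters: "{u. 0 < u \<and> u \<le> M \<and> p \<in> tube u v} \<in> sets borel"
proof -
  have "{u. 0 < u \<and> u \<le> M \<and> p \<in> tube u v} = {u. 0 < u \<and> u \<le> M \<and>
      v * sqrt (1 + u\<^sup>2) < fst p + u * snd p \<and> fst p + u * snd p \<le> (v + 1) * sqrt (1 + u\<^sup>2)}"
    using tube_iff[of _ "fst p" "snd p" v] by auto
  also have "\<dots> \<in> sets borel" by measurable
  finally show ?thesis .
qed

text \<open>Around any one admissible parameter \<open>w\<close>, all others lie within
  \<open>C / r\<close>, since a point outside \<open>square r\<close> has max-norm above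
  \<open>r\<close>. The constant is uniform in the point, which allows summation over
  \<open>E\<close>.\<close>

lemma emeasure_tube_parameters_le:
  assumes "0 \<le> M"
  obtains C where "0 \<le> C"
    "\<And>p r. 0 < r \<Longrightarrow> p \<notin> square r \<Longrightarrow>
      emeasure lborel {u. 0 < u \<and> u \<le> M \<and> p \<in> tube u v} \<le> ennreal (C / r)"
proof -
  define C where "C = (2 + 3 * M) * ((\<bar>v\<bar> + 1) * sqrt (1 + M\<^sup>2))"
  have C: "0 \<le> C" using assms by (simp add: C_def)
  have "emeasure lborel {u. 0 < u \<and> u \<le> M \<and> p \<in> tube u v} \<le> ennreal (2 * C / r)"
    if r: "0 < r" and p: "p \<notin> square r" for p r
  proof (cases "{u. 0 < u \<and> u \<le> M \<and> p \<in> tube u v} = {}")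
    case True
    then show ?thesis by (simp only: emeasure_empty zero_le)
  next
    case False
    then obtain w where w: "0 < w" "w \<le> M" "p \<in> tube w v" by auto
    obtain x y where xy: "p = (x, y)" by force
    have big: "r \<le> max \<bar>x\<bar> \<bar>y\<bar>" using p by (auto simp: xy)
    have "{u. 0 < u \<and> u \<le> M \<and> p \<in> tube u v} \<subseteq> {w - C / r..w + C / r}"
    proof
      fix u assume "u \<in> {u. 0 < u \<and> u \<le> M \<and> p \<in> tube u v}"
      then have "max \<bar>x\<bar> \<bar>y\<bar> * \<bar>u - w\<bar> \<le> C"
        unfolding C_def using tube_parameters_close[of u M w x y v] w by (auto simp: xy)
      then have "r * \<bar>u - w\<bar> \<le> C"
        using mult_right_mono[OF big, of "\<bar>u - w\<bar>"] by simp
      then have "\<bar>u - w\<bar> \<le> C / r" using r by (simp add: field_simps)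
      then show "u \<in> {w - C / r..w + C / r}" by (auto simp: abs_le_iff)
    qed
    then have "emeasure lborel {u. 0 < u \<and> u \<le> M \<and> p \<in> tube u v} \<le> emeasure lborel {w - C / r..w + C / r}"
      by (intro emeasure_mono) auto
    also have "\<dots> = ennreal (2 * C / r)" using C r by simp
    finally show ?thesis .
  qed
  then show thesis using that[of "2 * C"] C by simp
qed

section \<open>Almost every parameter in a bounded range\<close>

lemma AE_mass_dimension_tube_le:
  fixes d :: real
  assumes E: "one_separated E" and dim: "mass_dimension E < ereal d" and "1 < d" and "0 \<le> M"
  shows "AE u in lborel. 0 < u \<and> u \<le> M \<longrightarrow> mass_dimension (E \<inter> tube u v) \<le> ereal (d - 1)"
proof -
  \<comment> \<open>The room between \<open>d'\<close> and \<open>d\<close> will make the series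
    geometric with ratio below 1. Taking the maximum with 1 gives \<open>1 < d'\<close> and rules
    out an infinite \<open>e\<close>.\<close>
  obtain e where "max 1 (mass_dimension E) < e" "e < ereal d"
    using dense[of "max 1 (mass_dimension E)" "ereal d"] dim \<open>1 < d\<close> by auto
  then obtain d' where d': "mass_dimension E < ereal d'" "1 < d'" "d' < d"
    by (cases e) auto
  note fin = one_separated_imp_finite_square[OF E]
  obtain K where K: "0 \<le> K" "\<And>l. 1 \<le> l \<Longrightarrow> real (card (E \<inter> square l)) \<le> K * (2 * l) powr d'"
    using card_le_powr_of_mass_dimension_less[OF fin d'(1)] d'(2) by auto
  obtain C where C: "0 \<le> C" "\<And>p r. 0 < r \<Longrightarrow> p \<notin> square r \<Longrightarrow>
      emeasure lborel {u. 0 < u \<and> u \<le> M \<and> p \<in> tube u v} \<le> ennreal (C / r)"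
    using emeasure_tube_parameters_le[OF \<open>0 \<le> M\<close>] by blast
  define T where "T p = {u. 0 < u \<and> u \<le> M \<and> p \<in> tube u v}" for p
  have T [measurable]: "T p \<in> sets borel" for p
    unfolding T_def by (rule sets_tube_parameters)
  define A where "A k = E \<inter> square (2 ^ Suc k) - square (2 ^ k)" for k
  have A: "finite (A k)" for k using fin by (auto simp: A_def)
  \<comment> \<open>The weights balance the growth: \<open>A k\<close> has at most K 4^d' 2^(k d')
    points, each with parameter set of measure at most C / 2^k. Multiplying by 2^(-k(d-1)) leaves a
    constant times 2^(k(d'-d)), that is, \<open>q ^ k\<close>.\<close>
  define a where "a k = 2 powr (- (real k * (d - 1)))" for k
  define f where "f u = (\<Sum>k. ennreal (a k) * (\<Sum>p\<in>A k. indicator (T p) u))" for u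
  have f [measurable]: "f \<in> borel_measurable lborel" unfolding f_def by measurable
  define q where "q = 2 powr (d' - d)"
  have q: "0 \<le> q" "q < 1" using d' by (auto simp: q_def powr_less_one)
  have term_le: "ennreal (a k) * (\<Sum>p\<in>A k. emeasure lborel (T p)) \<le> ennreal (K * 4 powr d' * C * q ^ k)" for k
  proof -
    have "(\<Sum>p\<in>A k. emeasure lborel (T p)) \<le> (\<Sum>p\<in>A k. ennreal (C / 2 ^ k))"
      unfolding T_def by (intro sum_mono C(2)) (auto simp: A_def)
    also have "\<dots> = ennreal (real (card (A k)) * (C / 2 ^ k))"
      by (subst ennreal_mult) (use C(1) in \<open>auto simp: ennreal_of_nat_eq_real_of_nat\<close>)
    finally have "ennreal (a k) * (\<Sum>p\<in>A k. emeasure lborel (T p))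
        \<le> ennreal (a k) * ennreal (real (card (A k)) * (C / 2 ^ k))"
      by (intro mult_left_mono) auto
    also have "\<dots> = ennreal (a k * (real (card (A k)) * (C / 2 ^ k)))"
      by (rule ennreal_mult[symmetric]) (use C(1) in \<open>auto simp: a_def\<close>)
    also have "\<dots> \<le> ennreal (a k * ((K * (2 * 2 ^ Suc k) powr d') * (C / 2 ^ k)))"
    proof -
      have "card (A k) \<le> card (E \<inter> square (2 ^ Suc k))"
        by (intro card_mono fin) (auto simp: A_def)
      also have "real \<dots> \<le> K * (2 * 2 ^ Suc k) powr d'"
        by (rule K(2)) (rule one_le_power, simp)
      finally show ?thesis
        using C(1) by (intro ennreal_leI mult_left_mono mult_right_mono) (auto simp: a_def)
    qed
    also have "a k * ((K * (2 * 2 ^ Suc k) powr d') * (C / 2 ^ k)) = K * 4 powr d' * C * q ^ k"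
    proof -
      have "(2 * 2 ^ Suc k) powr d' = 4 powr d' * (2 ^ k) powr d'"
        by (simp add: powr_mult[symmetric])
      also have "(2 ^ k :: real) powr d' = 2 powr (real k * d')"
        by (simp add: powr_realpow[symmetric] powr_powr)
      finally have 1: "(2 * 2 ^ Suc k) powr d' = 4 powr d' * 2 powr (real k * d')" .
      have 2: "1 / 2 ^ k = (2::real) powr (- real k)"
        by (simp add: powr_minus powr_realpow divide_inverse)
      have "q ^ k = q powr real k" by (simp add: q_def powr_realpow)
      also have "\<dots> = 2 powr ((d' - d) * real k)" by (simp add: q_def powr_powr)
      also have "(d' - d) * real k = - (real k * (d - 1)) + real k * d' + - real k"
        by (simp add: algebra_simps)
      also have "2 powr \<dots> = a k * 2 powr (real k * d') * (1 / 2 ^ k)"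
        unfolding a_def 2 by (simp only: powr_add)
      finally show ?thesis unfolding 1 by simp
    qed
    finally show ?thesis .
  qed
  have "(\<integral>\<^sup>+u. f u \<partial>lborel) = (\<Sum>k. ennreal (a k) * (\<Sum>p\<in>A k. emeasure lborel (T p)))"
    unfolding f_def by (simp add: nn_integral_suminf nn_integral_cmult nn_integral_sum)
  also have "\<dots> \<le> (\<Sum>k. ennreal (K * 4 powr d' * C * q ^ k))"
    by (intro suminf_le term_le) auto
  also have "\<dots> < \<infinity>"
  proof -
    have "summable (\<lambda>k. K * 4 powr d' * C * q ^ k)"
      using q by (intro summable_mult summable_geometric) auto
    then have "(\<Sum>k. ennreal (K * 4 powr d' * C * q ^ k)) \<noteq> top"
      using q K(1) C(1) by (intro ennreal_suminf_neq_top) auto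
    then show ?thesis by (simp add: less_top)
  qed
  finally have "AE u in lborel. f u \<noteq> \<infinity>"
    by (intro nn_integral_noteq_infinite) auto
  then show ?thesis
  proof eventually_elim
    case (elim u)
    show ?case
    proof
      assume u: "0 < u \<and> u \<le> M"
      obtain G where G: "0 \<le> G" "f u = ennreal G" using elim by (cases "f u") auto
      define N where "N k = card (A k \<inter> tube u v)" for k
      have N: "(\<Sum>p\<in>A k. indicator (T p) u) = ennreal (real (N k))" for k
      proof -
        have "(\<Sum>p\<in>A k. indicator (T p) u :: ennreal) = (\<Sum>p\<in>A k. indicator (tube u v) p)"
          using u by (intro sum.cong) (auto simp: T_def indicator_def)
        also have "\<dots> = of_nat (N k)"
          using A by (simp add: N_def indicator_def of_bool_def sum.If_cases)
        finally show ?thesis by (simp add: ennreal_of_nat_eq_real_of_nat)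
      qed
      \<comment> \<open>The weights decrease because \<open>1 < d\<close>, so for
        \<open>j < k\<close> the weight \<open>a j\<close> may be replaced by the smaller
        \<open>a k\<close>. The finite value of the series then bounds the unweighted partial sum by
        \<open>G / a k\<close>.\<close>
      have sum_N: "(\<Sum>j<k. real (N j)) \<le> G * 2 powr (real k * (d - 1))" for k
      proof -
        have "ennreal (\<Sum>j<k. a k * real (N j)) = (\<Sum>j<k. ennreal (a k) * ennreal (real (N j)))"
          by (simp add: sum_ennreal[symmetric] ennreal_mult a_def)
        also have "\<dots> \<le> (\<Sum>j<k. ennreal (a j) * ennreal (real (N j)))"
          using \<open>1 < d\<close> by (intro sum_mono mult_right_mono ennreal_leI) (auto simp: a_def)
        also have "\<dots> \<le> f u"
          unfolding f_def N by (intro sum_le_suminf) auto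
        finally have "a k * (\<Sum>j<k. real (N j)) \<le> G"
          using G by (simp add: sum_distrib_left)
        then have "a k * (\<Sum>j<k. real (N j)) * 2 powr (real k * (d - 1)) \<le> G * 2 powr (real k * (d - 1))"
          by (rule mult_right_mono) simp
        also have "a k * (\<Sum>j<k. real (N j)) * 2 powr (real k * (d - 1))
            = (a k * 2 powr (real k * (d - 1))) * (\<Sum>j<k. real (N j))"
          by (simp only: mult_ac)
        also have "a k * 2 powr (real k * (d - 1)) = 1"
          by (simp add: a_def flip: powr_add)
        finally show ?thesis by simp
      qed
      show "mass_dimension (E \<inter> tube u v) \<le> ereal (d - 1)"
      proof (rule mass_dimension_le_of_card_le_powr)
        show "finite (E \<inter> tube u v \<inter> square l)" for l
          by (rule finite_subset[OF _ fin[of l]]) auto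
        fix l :: real assume l: "1 \<le> l"
        \<comment> \<open>This is the first dyadic scale with \<open>l \<le> 2 ^ k\<close>. Rounding
          up costs at most a factor 2, so 2^k \<le> 2 l, which matches the base \<open>2 * l\<close>
          of the required bound.\<close>
        define k where "k = nat \<lceil>log 2 l\<rceil>"
        have "0 \<le> log 2 l" using l by simp
        then have k: "log 2 l \<le> real k" "real k \<le> log 2 l + 1" unfolding k_def by linarith+
        have l_le: "l \<le> 2 ^ k"
          using k(1) l by (simp add: log_le_iff powr_realpow)
        have le_2l: "2 powr real k \<le> 2 * l"
        proof -
          have "2 powr real k \<le> 2 powr (log 2 l + 1)" using k(2) by simp
          also have "\<dots> = 2 * l" using l by (simp add: powr_add)
          finally show ?thesis .
        qed
        \<comment> \<open>The annuli start at radius 2^0 = 1. The finitely many points of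
          \<open>E\<close> in \<open>square 1\<close> are counted separately and enter the final
          constant.\<close>
        have cover: "E \<inter> square (2 ^ k) \<subseteq> (E \<inter> square 1) \<union> (\<Union>j<k. A j)" for k
        proof (induction k)
          case (Suc k)
          have "E \<inter> square (2 ^ Suc k) \<subseteq> (E \<inter> square (2 ^ k)) \<union> A k"
            unfolding A_def by blast
          then show ?case using Suc by (auto simp: lessThan_Suc)
        qed auto
        have "square l \<subseteq> square (2 ^ k)" using l_le by (intro Sigma_mono) auto
        then have "E \<inter> tube u v \<inter> square l \<subseteq> (E \<inter> square 1) \<union> (\<Union>j<k. A j \<inter> tube u v)"
          using cover[of k] by blast
        then have "card (E \<inter> tube u v \<inter> square l) \<le> card ((E \<inter> square 1) \<union> (\<Union>j<k. A j \<inter> tube u v))"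
          using fin A by (intro card_mono) auto
        also have "\<dots> \<le> card (E \<inter> square 1) + (\<Sum>j<k. N j)"
          unfolding N_def
          by (rule order_trans[OF card_Un_le add_left_mono[OF card_UN_le]]) auto
        finally have "real (card (E \<inter> tube u v \<inter> square l)) \<le> real (card (E \<inter> square 1)) + (\<Sum>j<k. real (N j))"
          by (simp flip: of_nat_sum of_nat_add)
        also have "\<dots> \<le> real (card (E \<inter> square 1)) * (2 * l) powr (d - 1) + G * (2 * l) powr (d - 1)"
        proof (rule add_mono)
          have "1 \<le> (2 * l) powr (d - 1)" using l \<open>1 < d\<close> by (intro ge_one_powr_ge_zero) auto
          then show "real (card (E \<inter> square 1)) \<le> real (card (E \<inter> square 1)) * (2 * l) powr (d - 1)"
            using mult_left_mono by fastforce
          have "2 powr (real k * (d - 1)) = (2 powr real k) powr (d - 1)" by (simp add: powr_powr)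
          also have "\<dots> \<le> (2 * l) powr (d - 1)" using le_2l \<open>1 < d\<close> by (intro powr_mono2) auto
          finally show "(\<Sum>j<k. real (N j)) \<le> G * (2 * l) powr (d - 1)"
            using order_trans[OF sum_N] mult_left_mono[OF _ G(1)] by blast
        qed
        finally show "real (card (E \<inter> tube u v \<inter> square l)) \<le> (real (card (E \<inter> square 1)) + G) * (2 * l) powr (d - 1)"
          by (simp add: algebra_simps)
      qed
    qed
  qed
qed

section \<open>From bounded parameter ranges to almost every positive parameter\<close>

theorem theorem1p8:
  fixes E :: "(real \<times> real) set" and v :: real
  assumes "one_separated E"
  shows "AE u in lebesgue_on {0<..}.
    mass_dimension (E \<inter> tube u v) \<le> max 0 (mass_dimension E - 1)"
proof (cases "mass_dimension E = \<infinity>")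
  case False
  \<comment> \<open>With \<open>D\<close> the larger of 1 and the dimension, the right-hand side
    becomes \<open>D - 1\<close>; this also covers dimension minus infinity. In the other case,
    dimension plus infinity, the right-hand side is infinite.\<close>
  define D where "D = real_of_ereal (max 1 (mass_dimension E))"
  have D: "max 1 (mass_dimension E) = ereal D"
    using False unfolding D_def by (cases "mass_dimension E") (auto simp: max_def)
  have "1 \<le> D" "mass_dimension E \<le> ereal D"
    using D by (metis ereal_less_eq(3) max.cobounded1 one_ereal_def) (metis D max.cobounded2)
  have max: "max 0 (mass_dimension E - 1) = ereal (D - 1)"
    using D by (cases "mass_dimension E") (auto simp: max_def one_ereal_def zero_ereal_def split: if_splits)
  \<comment> \<open>The exponents D + 1/(n+1) strictly exceed both 1 and the dimension, as the
    bounded-range lemma requires. Only countably many pairs \<open>n\<close>, \<open>m\<close>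
    occur, so one null set serves all: \<open>m\<close> exhausts the half-line and \<open>n\<close>
    lets the exponent decrease to \<open>D\<close>.\<close>
  have "AE u in lborel. \<forall>n m. 0 < u \<and> u \<le> real m \<longrightarrow>
      mass_dimension (E \<inter> tube u v) \<le> ereal (D + 1 / real (Suc n) - 1)"
    unfolding AE_all_countable
  proof (intro allI AE_mass_dimension_tube_le assms)
    fix n :: nat
    have "ereal D < ereal (D + 1 / real (Suc n))" by simp
    then show "mass_dimension E < ereal (D + 1 / real (Suc n))"
      using \<open>mass_dimension E \<le> ereal D\<close> by (rule le_less_trans[rotated])
    have "0 < 1 / real (Suc n)" by simp
    then show "1 < D + 1 / real (Suc n)" using \<open>1 \<le> D\<close> by linarith
  qed simp
  then have "AE u in lborel. u \<in> {0<..} \<longrightarrow> mass_dimension (E \<inter> tube u v) \<le> ereal (D - 1)"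
  proof eventually_elim
    case (elim u)
    show ?case
    proof
      assume "u \<in> {0<..}"
      moreover obtain m where "u \<le> real m" using real_arch_simple by blast
      ultimately have le: "mass_dimension (E \<inter> tube u v) \<le> ereal (D + 1 / real (Suc n) - 1)" for n
        using elim by auto
      have "(\<lambda>n. D + 1 / real (Suc n) - 1) \<longlonglongrightarrow> D + 0 - 1"
        by (intro tendsto_intros LIMSEQ_Suc lim_1_over_n)
      then have "(\<lambda>n. ereal (D + 1 / real (Suc n) - 1)) \<longlonglongrightarrow> ereal (D - 1)"
        by (intro tendsto_ereal) simp
      then show "mass_dimension (E \<inter> tube u v) \<le> ereal (D - 1)"
        by (rule LIMSEQ_le_const) (use le in blast)
    qed
  qed
  \<comment> \<open>A Borel null set is also null for the completed measure, so the statement passes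
    to Lebesgue measure restricted to the half-line.\<close>
  then show ?thesis
    unfolding max by (subst AE_restrict_space_iff) (auto intro: AE_completion)
qed simp

end
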